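(* Let $\mathbf f^{\mathrm P}$, $\mathbf f^{\mathrm M}$, $\mathbf f^{\mathrm V}$ be the pipe, pump and valve nonlinearities of a water distribution network (as defined in the context) on $\Omega^{\mathrm P}$, $\Omega^{\mathrm M}$, $\Omega^{\mathrm V}$, and let $\mathbf f=(\mathbf f^{\mathrm P},\mathbf f^{\mathrm M},\mathbf f^{\mathrm V})$ be the network nonlinearity on $\Omega=\Omega^{\mathrm P}\times\Omega^{\mathrm M}\times\Omega^{\mathrm V}$. If $K^{\mathrm P}$, $K^{\mathrm M}$, $K^{\mathrm V}$ are the Lipschitz constants of $\mathbf f^{\mathrm P}$, $\mathbf f^{\mathrm M}$, $\mathbf f^{\mathrm V}$ respectively, then the Lipschitz constant $K$ of $\mathbf f$ on $\Omega$ is $$K=\max\{K^{\mathrm P},K^{\mathrm M},K^{\mathrm V}\}.$$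
   Context: "The Lipschitz constant" of a function $\mathbf g:D\subseteq\mathbb R^n\to\mathbb R^m$ means the smallest $K\ge 0$ with $\|\mathbf g(\mathbf z_1)-\mathbf g(\mathbf z_2)\|_2\le K\|\mathbf z_1-\mathbf z_2\|_2$ for all $\mathbf z_1,\mathbf z_2\in D$ (Euclidean norms). The network has $n_p$ pipes, $n_m$ pumps and $n_v$ valves. The flow through each link lies in a compact interval, with $q^{\min}<q^{\max}$ the bounds for that link; $\Omega^{\mathrm P}\subset\mathbb R^{n_p}$, $\Omega^{\mathrm M}\subset\mathbb R^{n_m}$, $\Omega^{\mathrm V}\subset\mathbb R^{n_v}$ are the Cartesian products of the flow intervals of the pipes, pumps, valves respectively. Each of the three functions below maps the vector of flows through the corresponding links componentwise: - Pipes: $f^{\mathrm P}_i=R^{\mathrm P}_i\,q_i|q_i|^{\mu_{\mathrm P}-1}$, $R^{\mathrm P}_i>0$, $\mu_{\mathrm P}\ge 1$ fixed (the same for all pipes). - Pumps: $f^{\mathrm M}_i=-h_i^{\mathrm s}s_i^2+r_i\,q_i^{\nu_i}s_i^{2-\nu_i}$, with $q_i^{\min}>0$ and $r_i>0$, $s_i\in(0,1]$, $1\le\nu_i\le3$, $h_i^{\mathrm s}>0$ fixed. - Valves: $f^{\mathrm V}_i=o_iR^{\mathrm V}_i\,q_i|q_i|^{\mu_{\mathrm V}-1}$, $R^{\mathrm V}_i>0$, $o_i\in(0,1]$, $1\le\mu_{\mathrm V}\le 3$ fixed ($\mu_{\mathrm V}$ the same for all valves). If a class of links is empty, its Lipschitz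 constant is taken to be $0$. For an exponent $\mu=1$, powers with exponent $\mu-1=0$ are read as $1$. *)

theory Defs
  imports Complex_Main "Jordan_Normal_Form.Matrix"
begin

(* Vectors of R^n are the elements of carrier_vec n, so that n = 0 (an empty class of links)
   is covered. The type 'a vec carries no norm, hence the Euclidean norm below. *)

definition euclidean_norm :: "real vec \<Rightarrow> real" where
  "euclidean_norm x = sqrt (x \<bullet> x)"

definition lipschitz_bound :: "real vec set \<Rightarrow> (real vec \<Rightarrow> real vec) \<Rightarrow> real \<Rightarrow> bool" where
  "lipschitz_bound D g K \<longleftrightarrow> 0 \<le> K \<and>
     (\<forall>x\<in>D. \<forall>y\<in>D. euclidean_norm (g x - g y) \<le> K * euclidean_norm (x - y))"

definition is_lipschitz_constant :: "real vec set \<Rightarrow> (real vec \<Rightarrow> real vec) \<Rightarrow> real \<Rightarrow> bool" where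
  "is_lipschitz_constant D g K \<longleftrightarrow>
     lipschitz_bound D g K \<and> (\<forall>L. lipschitz_bound D g L \<longrightarrow> K \<le> L)"

lemma is_lipschitz_constant_unique:
  "is_lipschitz_constant D g K \<Longrightarrow> is_lipschitz_constant D g L \<Longrightarrow> K = L"
  unfolding is_lipschitz_constant_def by (meson order_antisym)

(* In particular the Lipschitz constant attached to an empty class of links is 0. *)
lemma is_lipschitz_constant_dim_0:
  assumes "D \<subseteq> carrier_vec 0" and "\<And>x. x \<in> D \<Longrightarrow> g x \<in> carrier_vec 0"
  shows "is_lipschitz_constant D g K \<longleftrightarrow> K = 0"
proof -
  have "euclidean_norm (g x - g y) = 0" if "x \<in> D" "y \<in> D" for x y
    using assms(2)[OF that(1)] assms(2)[OF that(2)]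
    by (simp add: euclidean_norm_def scalar_prod_def)
  moreover have "euclidean_norm (x - y) = 0" if "x \<in> D" "y \<in> D" for x y
    using subsetD[OF assms(1) that(1)] subsetD[OF assms(1) that(2)]
    by (simp add: euclidean_norm_def scalar_prod_def)
  ultimately have "lipschitz_bound D g L \<longleftrightarrow> 0 \<le> L" for L
    by (simp add: lipschitz_bound_def)
  then show ?thesis
    by (auto simp: is_lipschitz_constant_def intro: order_antisym)
qed

definition flow_box :: "nat \<Rightarrow> (nat \<Rightarrow> real) \<Rightarrow> (nat \<Rightarrow> real) \<Rightarrow> real vec set" where
  "flow_box n qmin qmax = {q \<in> carrier_vec n. \<forall>i<n. q $ i \<in> {qmin i..qmax i}}"

(* For mu = 1 and q $ i = 0 the factor 0 powr 0 is 0 rather than 1; the value of the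
   product is 0 under either convention. The same remark applies to valve_fun. *)
definition pipe_fun :: "nat \<Rightarrow> (nat \<Rightarrow> real) \<Rightarrow> real \<Rightarrow> real vec \<Rightarrow> real vec" where
  "pipe_fun n R \<mu> q = vec n (\<lambda>i. R i * (q $ i * \<bar>q $ i\<bar> powr (\<mu> - 1)))"

definition pump_fun ::
  "nat \<Rightarrow> (nat \<Rightarrow> real) \<Rightarrow> (nat \<Rightarrow> real) \<Rightarrow> (nat \<Rightarrow> real) \<Rightarrow> (nat \<Rightarrow> real) \<Rightarrow> real vec \<Rightarrow> real vec" where
  "pump_fun n h s r \<nu> q =
     vec n (\<lambda>i. - h i * (s i)\<^sup>2 + r i * (q $ i) powr (\<nu> i) * (s i) powr (2 - \<nu> i))"

(* c i is the degree of opening o_i of the i-th valve. *)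
definition valve_fun ::
  "nat \<Rightarrow> (nat \<Rightarrow> real) \<Rightarrow> (nat \<Rightarrow> real) \<Rightarrow> real \<Rightarrow> real vec \<Rightarrow> real vec" where
  "valve_fun n c R \<mu> q = vec n (\<lambda>i. c i * R i * (q $ i * \<bar>q $ i\<bar> powr (\<mu> - 1)))"

definition network_box :: "real vec set \<Rightarrow> real vec set \<Rightarrow> real vec set \<Rightarrow> real vec set" where
  "network_box DP DM DV = {p @\<^sub>v m @\<^sub>v v | p m v. p \<in> DP \<and> m \<in> DM \<and> v \<in> DV}"

definition network_fun ::
  "nat \<Rightarrow> nat \<Rightarrow> nat \<Rightarrow> (real vec \<Rightarrow> real vec) \<Rightarrow> (real vec \<Rightarrow> real vec) \<Rightarrow> (real vec \<Rightarrow> real vec)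
    \<Rightarrow> real vec \<Rightarrow> real vec" where
  "network_fun np nm nv fP fM fV q =
     fP (vec_first q np) @\<^sub>v fM (vec_first (vec_last q (nm + nv)) nm) @\<^sub>v fV (vec_last q nv)"

lemma network_fun_append:
  assumes "p \<in> carrier_vec np" "m \<in> carrier_vec nm" "v \<in> carrier_vec nv"
  shows "network_fun np nm nv fP fM fV (p @\<^sub>v m @\<^sub>v v) = fP p @\<^sub>v fM m @\<^sub>v fV v"
proof -
  have "vec_first (p @\<^sub>v m @\<^sub>v v) np = p"
    and "vec_last (p @\<^sub>v m @\<^sub>v v) (nm + nv) = m @\<^sub>v v"
    and "vec_first (m @\<^sub>v v) nm = m"
    and "vec_last (p @\<^sub>v m @\<^sub>v v) nv = v"
    using assms by (auto simp: vec_first_def vec_last_def)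
  then show ?thesis
    by (simp add: network_fun_def)
qed

end

theory Submission
  imports Defs
begin

text \<open>
  A constant \<open>L\<close> is a Lipschitz bound of a direct sum \<open>(x, y) \<mapsto> (f x, g y)\<close> on a product of
  nonempty sets iff it is one of both summands. If it works for both, the squared estimates
  \<open>\<parallel>f x - f x'\<parallel>\<^sup>2 \<le> L\<^sup>2 \<parallel>x - x'\<parallel>\<^sup>2\<close> and \<open>\<parallel>g y - g y'\<parallel>\<^sup>2 \<le> L\<^sup>2 \<parallel>y - y'\<parallel>\<^sup>2\<close> add up, by Pythagoras. Conversely,
  freezing one component at a point of its domain removes it from both sides of the estimate,
  so the other summand inherits the bound; this is where nonemptiness enters.

  Applied twice (\<open>lipschitz_bound_direct_sum\<close>), this says that the Lipschitz bounds of the network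
  nonlinearity are exactly the common Lipschitz bounds of the three classes of links. As the
  Lipschitz bounds of a map form an upward closed set (\<open>lipschitz_bound_mono\<close>), the least common
  bound is the maximum of the three least bounds (\<open>is_lipschitz_constant_Max\<close>).
  The argument applies to the network because each link law sees only the flows of its own class and the
  intervals \<open>qmin < qmax\<close> make every flow box nonempty.
\<close>

lemma scalar_prod_self_nonneg: "0 \<le> (x :: real vec) \<bullet> x"
  by (simp add: scalar_prod_def sum_nonneg)

lemma euclidean_norm_nonneg: "0 \<le> euclidean_norm x"
  by (simp add: euclidean_norm_def scalar_prod_self_nonneg)

lemma euclidean_norm_power2: "(euclidean_norm x)\<^sup>2 = x \<bullet> x"
  by (simp add: euclidean_norm_def scalar_prod_self_nonneg)

lemma euclidean_norm_append_diff_power2: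
  assumes "a \<in> carrier_vec n" "a' \<in> carrier_vec n" "b \<in> carrier_vec m" "b' \<in> carrier_vec m"
  shows "(euclidean_norm ((a @\<^sub>v b) - (a' @\<^sub>v b')))\<^sup>2
    = (euclidean_norm (a - a'))\<^sup>2 + (euclidean_norm (b - b'))\<^sup>2"
proof -
  have "(a @\<^sub>v b) - (a' @\<^sub>v b') = ((a - a') @\<^sub>v (b - b'))"
    using assms by (intro eq_vecI) auto
  moreover have "a - a' \<in> carrier_vec n" "b - b' \<in> carrier_vec m"
    using assms by auto
  ultimately show ?thesis
    by (simp add: euclidean_norm_power2 scalar_prod_append)
qed

lemma lipschitz_bound_mono:
  assumes "lipschitz_bound D f K" "K \<le> L"
  shows "lipschitz_bound D f L"
proof -
  have "K * euclidean_norm z \<le> L * euclidean_norm z" for z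
    using assms(2) euclidean_norm_nonneg by (rule mult_right_mono)
  then show ?thesis
    using assms unfolding lipschitz_bound_def by (meson order_trans)
qed

text \<open>Pythagoras is an identity between squared norms, so the Lipschitz estimate is used
  in its squared form.\<close>

lemma lipschitz_bound_iff_power2:
  "lipschitz_bound D f L \<longleftrightarrow> 0 \<le> L \<and>
     (\<forall>x\<in>D. \<forall>y\<in>D. (euclidean_norm (f x - f y))\<^sup>2 \<le> L\<^sup>2 * (euclidean_norm (x - y))\<^sup>2)"
proof -
  have "euclidean_norm u \<le> L * euclidean_norm v \<longleftrightarrow>
      (euclidean_norm u)\<^sup>2 \<le> L\<^sup>2 * (euclidean_norm v)\<^sup>2" if "0 \<le> L" for u v
    using that euclidean_norm_nonneg
    by (simp add: power_mult_distrib[symmetric] power_mono_iff)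
  then show ?thesis
    unfolding lipschitz_bound_def by blast
qed

text \<open>Nonemptiness of the factors cannot be dropped: if \<open>E\<close> is empty, the product is empty and
  every \<open>L \<ge> 0\<close> is a bound on it, whatever \<open>f\<close> does on \<open>D\<close>.\<close>

lemma lipschitz_bound_direct_sum:
  assumes D: "D \<subseteq> carrier_vec n" "D \<noteq> {}" "\<And>x. x \<in> D \<Longrightarrow> f x \<in> carrier_vec n'"
    and E: "E \<subseteq> carrier_vec m" "E \<noteq> {}" "\<And>y. y \<in> E \<Longrightarrow> g y \<in> carrier_vec m'"
    and h: "\<And>x y. x \<in> D \<Longrightarrow> y \<in> E \<Longrightarrow> h (x @\<^sub>v y) = f x @\<^sub>v g y"
  shows "lipschitz_bound {x @\<^sub>v y | x y. x \<in> D \<and> y \<in> E} h L \<longleftrightarrow>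
    lipschitz_bound D f L \<and> lipschitz_bound E g L"
proof -
  let ?N = "\<lambda>z. (euclidean_norm z)\<^sup>2"
  have arg: "?N ((x @\<^sub>v y) - (x' @\<^sub>v y')) = ?N (x - x') + ?N (y - y')"
    if "x \<in> D" "x' \<in> D" "y \<in> E" "y' \<in> E" for x x' y y'
    using that D(1) E(1) by (intro euclidean_norm_append_diff_power2) auto
  have val: "?N (h (x @\<^sub>v y) - h (x' @\<^sub>v y')) = ?N (f x - f x') + ?N (g y - g y')"
    if "x \<in> D" "x' \<in> D" "y \<in> E" "y' \<in> E" for x x' y y'
    unfolding h[OF that(1,3)] h[OF that(2,4)]
    by (rule euclidean_norm_append_diff_power2[OF D(3) D(3) E(3) E(3)]) fact+
  have zero: "?N (z - z) = 0" for z
    by (simp add: euclidean_norm_power2 scalar_prod_def)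
  \<comment> \<open>\<open>x0\<close> and \<open>y0\<close> are where one component is frozen while the other varies.\<close>
  obtain x0 y0 where x0: "x0 \<in> D" and y0: "y0 \<in> E"
    using D(2) E(2) by blast
  show ?thesis
  proof
    assume L: "lipschitz_bound {x @\<^sub>v y | x y. x \<in> D \<and> y \<in> E} h L"
    then have *: "?N (f x - f x') + ?N (g y - g y') \<le> L\<^sup>2 * (?N (x - x') + ?N (y - y'))"
      if "x \<in> D" "x' \<in> D" "y \<in> E" "y' \<in> E" for x x' y y'
      using that unfolding lipschitz_bound_iff_power2 arg[OF that, symmetric] val[OF that, symmetric]
      by blast
    have "?N (f x - f x') \<le> L\<^sup>2 * ?N (x - x')" if "x \<in> D" "x' \<in> D" for x x'
      using *[OF that y0 y0] by (simp add: zero)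
    moreover have "?N (g y - g y') \<le> L\<^sup>2 * ?N (y - y')" if "y \<in> E" "y' \<in> E" for y y'
      using *[OF x0 x0 that] by (simp add: zero)
    ultimately show "lipschitz_bound D f L \<and> lipschitz_bound E g L"
      using L unfolding lipschitz_bound_iff_power2 by blast
  next
    assume L: "lipschitz_bound D f L \<and> lipschitz_bound E g L"
    have "?N (h (x @\<^sub>v y) - h (x' @\<^sub>v y')) \<le> L\<^sup>2 * ?N ((x @\<^sub>v y) - (x' @\<^sub>v y'))"
      if "x \<in> D" "x' \<in> D" "y \<in> E" "y' \<in> E" for x x' y y'
      using L that unfolding lipschitz_bound_iff_power2 arg[OF that] val[OF that] distrib_left
      by (intro add_mono) auto
    then show "lipschitz_bound {x @\<^sub>v y | x y. x \<in> D \<and> y \<in> E} h L"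
      using L unfolding lipschitz_bound_iff_power2 by blast
  qed
qed

text \<open>The least element of an intersection of upward closed sets of reals is the largest of
  their least elements.\<close>

lemma is_lipschitz_constant_Max:
  assumes "\<And>L. lipschitz_bound D h L \<longleftrightarrow>
      lipschitz_bound D1 f1 L \<and> lipschitz_bound D2 f2 L \<and> lipschitz_bound D3 f3 L"
    and "is_lipschitz_constant D1 f1 K1" "is_lipschitz_constant D2 f2 K2"
    and "is_lipschitz_constant D3 f3 K3"
  shows "is_lipschitz_constant D h (Max {K1, K2, K3})"
proof -
  have "K1 \<le> Max {K1, K2, K3}" "K2 \<le> Max {K1, K2, K3}" "K3 \<le> Max {K1, K2, K3}"
    by (auto intro: Max_ge)
  then have "lipschitz_bound D h (Max {K1, K2, K3})"
    using assms lipschitz_bound_mono unfolding is_lipschitz_constant_def by blast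
  moreover have "Max {K1, K2, K3} \<le> L" if "lipschitz_bound D h L" for L
    using that assms unfolding is_lipschitz_constant_def by simp
  ultimately show ?thesis
    unfolding is_lipschitz_constant_def by blast
qed

text \<open>The network is the direct sum of the pipes with the direct sum \<open>g\<close> of pumps and valves, so the
  binary criterion is used once at each level of this nesting.\<close>

lemma lipschitz_bound_network:
  assumes DP: "DP \<subseteq> carrier_vec np" "DP \<noteq> {}" "\<And>x. x \<in> DP \<Longrightarrow> fP x \<in> carrier_vec np'"
    and DM: "DM \<subseteq> carrier_vec nm" "DM \<noteq> {}" "\<And>x. x \<in> DM \<Longrightarrow> fM x \<in> carrier_vec nm'"
    and DV: "DV \<subseteq> carrier_vec nv" "DV \<noteq> {}" "\<And>x. x \<in> DV \<Longrightarrow> fV x \<in> carrier_vec nv'"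
  shows "lipschitz_bound (network_box DP DM DV) (network_fun np nm nv fP fM fV) L \<longleftrightarrow>
    lipschitz_bound DP fP L \<and> lipschitz_bound DM fM L \<and> lipschitz_bound DV fV L"
proof -
  define E where "E = {m @\<^sub>v v | m v. m \<in> DM \<and> v \<in> DV}"
  define g where "g = (\<lambda>w. fM (vec_first w nm) @\<^sub>v fV (vec_last w nv))"
  have g: "g (m @\<^sub>v v) = fM m @\<^sub>v fV v" if "m \<in> DM" "v \<in> DV" for m v
  proof -
    have "m \<in> carrier_vec nm" "v \<in> carrier_vec nv"
      using that DM(1) DV(1) by auto
    then have "vec_first (m @\<^sub>v v) nm = m" "vec_last (m @\<^sub>v v) nv = v"
      by (auto simp: vec_first_def vec_last_def)
    then show ?thesis
      by (simp add: g_def)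
  qed
  have E: "E \<subseteq> carrier_vec (nm + nv)" "E \<noteq> {}"
    using DM(1,2) DV(1,2) unfolding E_def by (blast intro: append_carrier_vec)+
  have gE: "g w \<in> carrier_vec (nm' + nv')" if "w \<in> E" for w
    using that g DM(3) DV(3) unfolding E_def by (auto intro: append_carrier_vec)
  have pg: "network_fun np nm nv fP fM fV (p @\<^sub>v w) = fP p @\<^sub>v g w" if p: "p \<in> DP" and wE: "w \<in> E" for p w
  proof -
    obtain m v where w: "w = m @\<^sub>v v" "m \<in> DM" "v \<in> DV"
      using wE unfolding E_def by blast
    have "p \<in> carrier_vec np" "m \<in> carrier_vec nm" "v \<in> carrier_vec nv"
      using p w DP(1) DM(1) DV(1) by auto
    then show ?thesis
      using w by (simp add: network_fun_append g)
  qed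
  have "network_box DP DM DV = {p @\<^sub>v w | p w. p \<in> DP \<and> w \<in> E}"
    unfolding network_box_def E_def by blast
  then have "lipschitz_bound (network_box DP DM DV) (network_fun np nm nv fP fM fV) L \<longleftrightarrow>
      lipschitz_bound DP fP L \<and> lipschitz_bound E g L"
    using lipschitz_bound_direct_sum[where f = fP and g = g, OF DP E gE pg] by simp
  also have "lipschitz_bound E g L \<longleftrightarrow> lipschitz_bound DM fM L \<and> lipschitz_bound DV fV L"
    unfolding E_def using lipschitz_bound_direct_sum[where f = fM and g = fV and h = g, OF DM DV g] by simp
  finally show ?thesis .
qed

lemma flow_box_subset_carrier: "flow_box n qmin qmax \<subseteq> carrier_vec n"
  by (auto simp: flow_box_def)

lemma flow_box_nonempty:
  assumes "\<And>i. i < n \<Longrightarrow> qmin i \<le> qmax i"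
  shows "flow_box n qmin qmax \<noteq> {}"
proof -
  have "vec n qmin \<in> flow_box n qmin qmax"
    using assms by (simp add: flow_box_def)
  then show ?thesis
    by blast
qed

theorem theorem1:
  fixes np nm nv :: nat
    and qminP qmaxP RP :: "nat \<Rightarrow> real" and \<mu>P :: real
    and qminM qmaxM h s r \<nu> :: "nat \<Rightarrow> real"
    and qminV qmaxV c RV :: "nat \<Rightarrow> real" and \<mu>V :: real
    and KP KM KV :: real
  defines "\<Omega>P \<equiv> flow_box np qminP qmaxP"
    and "\<Omega>M \<equiv> flow_box nm qminM qmaxM"
    and "\<Omega>V \<equiv> flow_box nv qminV qmaxV"
    and "fP \<equiv> pipe_fun np RP \<mu>P"
    and "fM \<equiv> pump_fun nm h s r \<nu>"
    and "fV \<equiv> valve_fun nv c RV \<mu>V"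
  assumes pipes: "\<forall>i<np. qminP i < qmaxP i \<and> 0 < RP i" "1 \<le> \<mu>P"
    and pumps: "\<forall>i<nm. 0 < qminM i \<and> qminM i < qmaxM i \<and> 0 < r i \<and> 0 < s i \<and> s i \<le> 1
                  \<and> 1 \<le> \<nu> i \<and> \<nu> i \<le> 3 \<and> 0 < h i"
    and valves: "\<forall>i<nv. qminV i < qmaxV i \<and> 0 < RV i \<and> 0 < c i \<and> c i \<le> 1" "1 \<le> \<mu>V" "\<mu>V \<le> 3"
    and "is_lipschitz_constant \<Omega>P fP KP"
    and "is_lipschitz_constant \<Omega>M fM KM"
    and "is_lipschitz_constant \<Omega>V fV KV"
  shows "is_lipschitz_constant (network_box \<Omega>P \<Omega>M \<Omega>V) (network_fun np nm nv fP fM fV)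
           (Max {KP, KM, KV})"
proof (rule is_lipschitz_constant_Max)
  have "\<Omega>P \<noteq> {}"
    unfolding \<Omega>P_def using pipes(1) by (intro flow_box_nonempty) (simp add: less_imp_le)
  moreover have "\<Omega>M \<noteq> {}"
    unfolding \<Omega>M_def using pumps by (intro flow_box_nonempty) (simp add: less_imp_le)
  moreover have "\<Omega>V \<noteq> {}"
    unfolding \<Omega>V_def using valves(1) by (intro flow_box_nonempty) (simp add: less_imp_le)
  moreover have "fP q \<in> carrier_vec np" "fM q \<in> carrier_vec nm" "fV q \<in> carrier_vec nv" for q
    by (simp_all add: fP_def fM_def fV_def pipe_fun_def pump_fun_def valve_fun_def)
  moreover have "\<Omega>P \<subseteq> carrier_vec np" "\<Omega>M \<subseteq> carrier_vec nm" "\<Omega>V \<subseteq> carrier_vec nv"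
    unfolding \<Omega>P_def \<Omega>M_def \<Omega>V_def by (rule flow_box_subset_carrier)+
  ultimately show "lipschitz_bound (network_box \<Omega>P \<Omega>M \<Omega>V) (network_fun np nm nv fP fM fV) L \<longleftrightarrow>
      lipschitz_bound \<Omega>P fP L \<and> lipschitz_bound \<Omega>M fM L \<and> lipschitz_bound \<Omega>V fV L" for L
    by (intro lipschitz_bound_network)
qed fact+

end
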